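(* Let $(L,\vee,\wedge,0,1)$ be a non-trivial complete lattice, let $T$ be a non-empty set, let $P,F\colon L^T\to L^T$ be tense operators on $L$ with time set $T$, and let $R$ denote the relation on $T$ induced by $P$ and $F$. Put $\bar T:=T_1\cup T\cup T_2$ where $T_1:=T\times\{1\}$ and $T_2:=T\times\{2\}$, and $$\bar R:=\{\big((s,1),s\big)\mid s\in T\}\cup R\cup\{\big(s,(s,2)\big)\mid s\in T\}\subseteq\bar T\times\bar T,$$ and let $\bar P,\bar F\colon L^{\bar T}\to L^{\bar T}$ denote the tense operators induced by the time frame $(\bar T,\bar R)$. For every $q\in L^T$ let $\bar q\in L^{\bar T}$ be defined by $$\bar q\big((s,1)\big):=P(q)(s),\quad \bar q(s):=q(s),\quad \bar q\big((s,2)\big):=F(q)(s)\quad\text{for all }s\in T.$$ Then $\bar R|T=R$, and $$\big(\bar P(\bar q)\big)|T=P(q)\quad\text{and}\quad\big(\bar F(\bar q)\big)|T=F(q)$$ for all $q\in L^T$.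
   Context: Tense operators on $L$ with time set $T$ (given abstractly, not from a time frame) are arbitrary maps $L^T\to L^T$, where $L^T$ is the set of all functions $T\to L$. Non-trivial means that $L$ has more than one element; $0$ and $1$ are its least and greatest elements. The sets $T_1$, $T$, $T_2$ are regarded as pairwise disjoint. The relation induced by $P$ and $F$ is $\{(s,t)\in T^2\mid q(s)\leq P(q)(t)\text{ and }q(t)\leq F(q)(s)\text{ for all }q\in L^T\}$. A time frame is a pair $(S,Q)$ of a non-empty set $S$ and a non-empty binary relation $Q$ on $S$. The tense operators $P_Q,F_Q\colon L^S\to L^S$ (playing the roles of $P$ and $F$) induced by $(S,Q)$ are defined, for $q\in L^S$ and $s\in S$, by $P_Q(q)(s):=\bigvee\{q(t)\mid t\mathrel Q s\}$ and $F_Q(q)(s):=\bigvee\{q(t)\mid s\mathrel Q t\}$, where the join of the empty set is $0$. Thus $\bar P=P_{\bar R}$ and $\bar F=F_{\bar R}$ for $S=\bar T$. $\bar R|T$ means $\bar R\cap T^2$, and $f|T$ for $f\in L^{\bar T}$ means the restriction of the function $f$ to $T$. *)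

theory Defs
  imports Main
begin

text \<open>
  The lattice \<open>L\<close> is a type \<open>'l\<close> of class \<^class>\<open>complete_lattice\<close>, the non-empty time set \<open>T\<close> is
  the type \<open>'t\<close>, and \<open>L\<^sup>T\<close> is the type \<open>'t \<Rightarrow> 'l\<close>.
\<close>

type_synonym ('t, 'l) tense_op = "('t \<Rightarrow> 'l) \<Rightarrow> ('t \<Rightarrow> 'l)"

definition induced_rel ::
  "('t, 'l::complete_lattice) tense_op \<Rightarrow> ('t, 'l) tense_op \<Rightarrow> ('t \<times> 't) set"
  where "induced_rel P F = {(s, t). \<forall>q. q s \<le> P q t \<and> q t \<le> F q s}"

definition frame_P :: "('s \<times> 's) set \<Rightarrow> ('s, 'l::complete_lattice) tense_op"
  where "frame_P Q q s = Sup {q t | t. (t, s) \<in> Q}"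

definition frame_F :: "('s \<times> 's) set \<Rightarrow> ('s, 'l::complete_lattice) tense_op"
  where "frame_F Q q s = Sup {q t | t. (s, t) \<in> Q}"

text \<open>
  The disjoint union \<open>T\<^sub>1 \<union> T \<union> T\<^sub>2\<close>: \<open>Copy1 s\<close> is \<open>(s, 1)\<close>, \<open>Orig s\<close> is \<open>s\<close> itself and
  \<open>Copy2 s\<close> is \<open>(s, 2)\<close>. The subset \<open>T\<close> is thus \<open>range Orig\<close>.
\<close>

datatype 't ext = Copy1 't | Orig 't | Copy2 't

definition ext_rel :: "('t \<times> 't) set \<Rightarrow> ('t ext \<times> 't ext) set"
  where "ext_rel R =
    {(Copy1 s, Orig s) | s. True} \<union> {(Orig s, Orig t) | s t. (s, t) \<in> R} \<union>
    {(Orig s, Copy2 s) | s. True}"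

text \<open>Hence \<open>ext_rel R\<close> makes \<open>'t ext\<close> a time frame, whose relation has to be non-empty.\<close>

lemma ext_rel_nonempty: "ext_rel R \<noteq> {}"
  by (auto simp: ext_rel_def)

primrec ext_fun ::
  "('t, 'l) tense_op \<Rightarrow> ('t, 'l) tense_op \<Rightarrow> ('t \<Rightarrow> 'l) \<Rightarrow> 't ext \<Rightarrow> 'l"
  where
    "ext_fun P F q (Copy1 s) = P q s"
  | "ext_fun P F q (Orig s) = q s"
  | "ext_fun P F q (Copy2 s) = F q s"

text \<open>Restrictions to the subset \<open>T\<close>, the function being read on \<open>'t\<close> via \<open>Orig\<close>.\<close>

definition restrict_rel :: "('t ext \<times> 't ext) set \<Rightarrow> ('t ext \<times> 't ext) set"
  where "restrict_rel Q = Q \<inter> (range Orig \<times> range Orig)"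

definition restrict_fun :: "('t ext \<Rightarrow> 'l) \<Rightarrow> 't \<Rightarrow> 'l"
  where "restrict_fun f = (\<lambda>s. f (Orig s))"

end

theory Submission
  imports Defs
begin

text \<open>At \<open>Orig s\<close> the join defining \<open>frame_P\<close> runs over
  \<open>Copy1 s\<close>, where \<open>ext_fun\<close> takes the value \<open>P q s\<close>, and
  over the R-predecessors of s, where \<open>induced_rel\<close> bounds every value by
  \<open>P q s\<close>. So the join is exactly \<open>P q s\<close>; \<open>Copy2 s\<close> does the
  same for F. \<open>frame_P_ext_rel_Orig\<close> and \<open>frame_F_ext_rel_Orig\<close> split the
  joins accordingly.\<close>

lemma frame_P_ext_rel_Orig:
  "frame_P (ext_rel R) q (Orig s) = sup (q (Copy1 s)) (SUP t\<in>{t. (t, s) \<in> R}. q (Orig t))"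
proof -
  have "{q u | u. (u, Orig s) \<in> ext_rel R} =
      insert (q (Copy1 s)) ((\<lambda>t. q (Orig t)) ` {t. (t, s) \<in> R})"
    by (auto simp: ext_rel_def)
  then show ?thesis
    by (simp add: frame_P_def)
qed

lemma frame_F_ext_rel_Orig:
  "frame_F (ext_rel R) q (Orig s) = sup (q (Copy2 s)) (SUP t\<in>{t. (s, t) \<in> R}. q (Orig t))"
proof -
  have "{q u | u. (Orig s, u) \<in> ext_rel R} =
      insert (q (Copy2 s)) ((\<lambda>t. q (Orig t)) ` {t. (s, t) \<in> R})"
    by (auto simp: ext_rel_def)
  then show ?thesis
    by (simp add: frame_F_def)
qed

text \<open>Every added edge has an endpoint in one of the two copies, so restriction removes
  it.\<close>

lemma restrict_rel_ext_rel: "restrict_rel (ext_rel R) = map_prod Orig Orig ` R"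
  by (auto simp: restrict_rel_def ext_rel_def)

theorem theorem5p8:
  fixes P F :: "('t, 'l::complete_lattice) tense_op"
    and R :: "('t \<times> 't) set"
  assumes nontrivial: "\<exists>x y :: 'l. x \<noteq> y"
    and R: "R = induced_rel P F"
  shows "restrict_rel (ext_rel R) = map_prod Orig Orig ` R \<and>
    (\<forall>q. restrict_fun (frame_P (ext_rel R) (ext_fun P F q)) = P q \<and>
         restrict_fun (frame_F (ext_rel R) (ext_fun P F q)) = F q)"
proof (intro conjI allI restrict_rel_ext_rel)
  fix q
  \<comment> \<open>Absorption leaves \<open>q t \<le> P q s\<close> for
    \<open>(t, s) \<in> R\<close>, the first conjunct of \<open>induced_rel\<close>.\<close>
  show "restrict_fun (frame_P (ext_rel R) (ext_fun P F q)) = P q"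
    by (auto simp: restrict_fun_def frame_P_ext_rel_Orig R induced_rel_def
        intro!: sup_absorb1 SUP_least)
  \<comment> \<open>Here the second conjunct is used, at \<open>(s, t) \<in> R\<close>.\<close>
  show "restrict_fun (frame_F (ext_rel R) (ext_fun P F q)) = F q"
    by (auto simp: restrict_fun_def frame_F_ext_rel_Orig R induced_rel_def
        intro!: sup_absorb1 SUP_least)
qed

end
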